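(* Let $n \ge 1$ and let $a_1, \dots, a_n > 0$ be positive real numbers. Then $$ \int_{\mathbb{R}} \left( \frac{\sin(2 \pi x)}{ 2 \pi x} \right)^2 \prod_{i=1}^{n} \bigl(\cos(2 \pi a_i x)\bigr)^2 \, dx \geq \frac{1}{2^{n+1}}.$$ Equality occurs if and only if all subset sums are at distance $\geq 1$ from each other, i.e. if and only if for any two distinct subsets $S, T \subseteq \{1, \dots, n\}$ one has $\left| \sum_{i \in S} a_i - \sum_{i \in T} a_i \right| \geq 1$.
   Context: The function $\sin(2\pi x)/(2\pi x)$ is understood to take the value $1$ at $x=0$. The empty set is allowed as a subset; its sum is $0$. *)

theory Defs
  imports "HOL-Probability.Probability"
begin

end

theory Submission
  imports Defs "HOL-Real_Asymp.Real_Asymp"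
begin

text \<open>
  Writing \<open>cos\<^sup>2 \<theta> = \<bar>1 + exp (2\<i>\<theta>)\<bar>\<^sup>2 / 4\<close> and multiplying out, the product of squared cosines becomes
  \<open>4\<^sup>-\<^sup>n\<close> times the sum, over pairs of subsets \<open>S, T\<close>, of \<open>cos (4\<pi> d x)\<close> with \<open>d\<close> the difference of the
  two subset sums. The Fourier transform of \<open>sinc\<^sup>2\<close> is a triangle function, so such a pair contributes
  \<open>max 0 (1 - \<bar>d\<bar>) / 2\<close> to the integral. The \<open>2\<^sup>n\<close> diagonal pairs already give \<open>1 / 2\<^sup>n\<^sup>+\<^sup>1\<close>, and the other
  pairs contribute nonnegative amounts, which vanish exactly when \<open>\<bar>d\<bar> \<ge> 1\<close>.
\<close>

text \<open>By Caratheodory's criterion: \<open>g\<close> itself is a continuous extension of the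
  difference quotient. It handles the point 0, where the quotient rule fails for
  \<open>(sin x)^2 / x\<close>.\<close>

lemma DERIV_mult_self_isCont_at_0:
  fixes g :: "real \<Rightarrow> real"
  assumes "isCont g 0"
  shows "((\<lambda>x. x * g x) has_real_derivative g 0) (at 0)"
  unfolding CARAT_DERIV using assms by (auto simp: mult.commute)

text \<open>Integration by parts of \<open>(sin x)^2 / x^2\<close> leaves the boundary term
  \<open>- (sin x)^2 / x\<close> and the integral of \<open>sin (2 * x) / x\<close>, which has the
  antiderivative \<open>Si (2 * x)\<close>.\<close>

lemma DERIV_Si_minus_sin_square_over:
  "((\<lambda>x. Si (2 * x) - (sin x)\<^sup>2 / x) has_real_derivative (sinc x)\<^sup>2) (at x)"
proof (cases "x = 0")
  case True
  have "isCont (\<lambda>x. (sinc x)\<^sup>2) 0"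
    by (intro continuous_intros isCont_sinc)
  from DERIV_mult_self_isCont_at_0[OF this]
  have "((\<lambda>x. x * (sinc x)\<^sup>2) has_real_derivative 1) (at 0)"
    by simp
  \<comment> \<open>Division by zero yields 0, so both sides agree at 0 too.\<close>
  moreover have "(\<lambda>x. x * (sinc x)\<^sup>2) = (\<lambda>x. (sin x)\<^sup>2 / x)"
    by (auto simp: fun_eq_iff power2_eq_square)
  moreover have "((\<lambda>x. Si (2 * x)) has_real_derivative sinc (2 * 0) * 2) (at 0)"
    by (rule DERIV_chain2[OF DERIV_Si]) (auto intro!: derivative_eq_intros)
  ultimately have "((\<lambda>x. Si (2 * x) - (sin x)\<^sup>2 / x) has_real_derivative 2 - 1) (at 0)"
    by (intro DERIV_diff) simp_all
  then show ?thesis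
    using True by simp
next
  case False
  have "((\<lambda>x. Si (2 * x)) has_real_derivative sinc (2 * x) * 2) (at x)"
    by (rule DERIV_chain2[OF DERIV_Si]) (auto intro!: derivative_eq_intros)
  moreover have "((\<lambda>x. (sin x)\<^sup>2 / x) has_real_derivative
      (2 * sin x * cos x * x - (sin x)\<^sup>2) / (x * x)) (at x)"
    using False by (auto intro!: derivative_eq_intros)
  ultimately have "((\<lambda>x. Si (2 * x) - (sin x)\<^sup>2 / x) has_real_derivative
      sinc (2 * x) * 2 - (2 * sin x * cos x * x - (sin x)\<^sup>2) / (x * x)) (at x)"
    by (rule DERIV_diff)
  moreover have "sinc (2 * x) * 2 - (2 * sin x * cos x * x - (sin x)\<^sup>2) / (x * x) = (sinc x)\<^sup>2"
    using False sin_double[of x] by (simp add: field_simps power2_eq_square)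
  ultimately show ?thesis
    by simp
qed

lemma tendsto_Si_minus_sin_square_over:
  "((\<lambda>x. Si (2 * x) - (sin x)\<^sup>2 / x) \<longlongrightarrow> pi / 2) at_top"
proof -
  have "filterlim (\<lambda>x::real. 2 * x) at_top at_top"
    by real_asymp
  then have "((\<lambda>x. Si (2 * x)) \<longlongrightarrow> pi / 2) at_top"
    by (rule filterlim_compose[OF Si_at_top])
  moreover have "((\<lambda>x::real. (sin x)\<^sup>2 / x) \<longlongrightarrow> 0) at_top"
    by real_asymp
  ultimately show ?thesis
    using tendsto_diff by fastforce
qed

lemma has_bochner_integral_sinc_square:
  "has_bochner_integral lborel (\<lambda>x. (sinc x)\<^sup>2) pi"
proof -
  let ?h = "\<lambda>x::real. indicator {0..} x *\<^sub>R (sinc x)\<^sup>2"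
  have "(\<integral>\<^sup>+x. ennreal ((sinc x)\<^sup>2) * indicator {0..} x \<partial>lborel)
      = pi / 2 - (Si (2 * 0) - (sin 0)\<^sup>2 / 0)"
    by (rule nn_integral_FTC_atLeast[OF _ DERIV_Si_minus_sin_square_over _
          tendsto_Si_minus_sin_square_over]) measurable
  \<comment> \<open>The lower boundary value vanishes: \<open>Si 0 = 0\<close>, and
    \<open>0 / 0 = 0\<close> by convention.\<close>
  also have "\<dots> = ennreal (pi / 2)"
    by (simp add: Si_alt_def zero_ereal_def)
  also have "(\<integral>\<^sup>+x. ennreal ((sinc x)\<^sup>2) * indicator {0..} x \<partial>lborel)
      = (\<integral>\<^sup>+x. ennreal (?h x) \<partial>lborel)"
    by (intro nn_integral_cong) (auto split: split_indicator)
  finally have "(\<integral>\<^sup>+x. ennreal (?h x) \<partial>lborel) = ennreal (pi / 2)" .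
  then have "has_bochner_integral lborel ?h (pi / 2)"
    by (intro has_bochner_integral_nn_integral) auto
  then have "has_bochner_integral lborel (\<lambda>x. (sinc x)\<^sup>2) (2 *\<^sub>R (pi / 2))"
    by (rule has_bochner_integral_even_function) simp
  then show ?thesis
    by simp
qed

text \<open>Substitution of \<open>t * x\<close>. The factor \<open>t^2\<close> turns the integrand
  into \<open>(sin (t * x))^2 / x^2\<close> away from 0 and keeps the formula valid for
  \<open>t = 0\<close>, so it can be used with \<open>d\<close> and \<open>d \<plusminus> 1\<close>
  for every \<open>d\<close>.\<close>

lemma has_bochner_integral_sinc_square_scaled:
  "has_bochner_integral lborel (\<lambda>x. t\<^sup>2 * (sinc (t * x))\<^sup>2) (pi * \<bar>t\<bar>)"
proof (cases "t = 0")
  case False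
  have "has_bochner_integral lborel (\<lambda>x. (sinc (0 + t * x))\<^sup>2) (pi /\<^sub>R \<bar>t\<bar>)"
    by (rule iffD1[OF lborel_has_bochner_integral_real_affine_iff[OF False]
          has_bochner_integral_sinc_square])
  then have "has_bochner_integral lborel (\<lambda>x. t\<^sup>2 * (sinc (0 + t * x))\<^sup>2) (t\<^sup>2 * (pi /\<^sub>R \<bar>t\<bar>))"
    by (rule has_bochner_integral_mult_right)
  moreover have "t\<^sup>2 * (pi /\<^sub>R \<bar>t\<bar>) = pi * \<bar>t\<bar>"
    using False by (simp add: field_simps power2_eq_square)
  ultimately show ?thesis
    by (simp only: add_0)
qed (simp add: has_bochner_integral_zero)

text \<open>Multiplied by \<open>u^2\<close>, the right-hand side is half the second difference of
  \<open>(sin (d * u))^2\<close> in \<open>d\<close> with step 1, and the addition formulas evaluate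
  it. This reduces the Fourier transform to integrals of rescaled squared sincs.\<close>

lemma sinc_square_mult_cos:
  "(sinc u)\<^sup>2 * cos (2 * d * u) =
    ((d + 1)\<^sup>2 * (sinc ((d + 1) * u))\<^sup>2 + (d - 1)\<^sup>2 * (sinc ((d - 1) * u))\<^sup>2) / 2
      - d\<^sup>2 * (sinc (d * u))\<^sup>2"
proof (cases "u = 0")
  case True
  then show ?thesis
    by (simp add: field_simps power2_eq_square)
next
  case False
  have sinc: "t\<^sup>2 * (sinc (t * u))\<^sup>2 = (sin (t * u))\<^sup>2 / u\<^sup>2" for t
    using False by (simp add: field_simps)
  have trig: "(sin u)\<^sup>2 * cos (2 * d * u)
      = ((sin ((d + 1) * u))\<^sup>2 + (sin ((d - 1) * u))\<^sup>2) / 2 - (sin (d * u))\<^sup>2"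
  proof -
    define p where "p = d * u"
    have d: "(d + 1) * u = p + u" "(d - 1) * u = p - u" "2 * d * u = 2 * p" "d * u = p"
      by (simp_all add: p_def algebra_simps)
    have c: "(cos u)\<^sup>2 = 1 - (sin u)\<^sup>2" "(cos p)\<^sup>2 = 1 - (sin p)\<^sup>2"
      by (simp_all add: cos_squared_eq)
    have "((sin (p + u))\<^sup>2 + (sin (p - u))\<^sup>2) / 2 = (sin p)\<^sup>2 * (cos u)\<^sup>2 + (cos p)\<^sup>2 * (sin u)\<^sup>2"
      by (simp add: sin_add sin_diff power2_eq_square field_simps)
    also have "\<dots> = (sin p)\<^sup>2 + (sin u)\<^sup>2 * (1 - 2 * (sin p)\<^sup>2)"
      unfolding c by (simp add: algebra_simps)
    finally show ?thesis
      unfolding d cos_double_sin by linarith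
  qed
  have "(sinc u)\<^sup>2 * cos (2 * d * u) = (sin u)\<^sup>2 * cos (2 * d * u) / u\<^sup>2"
    using False by (simp add: power_divide)
  then show ?thesis
    unfolding sinc trig by (simp add: diff_divide_distrib add_divide_distrib)
qed

lemma has_bochner_integral_sinc_square_cos:
  "has_bochner_integral lborel (\<lambda>x. (sinc (2 * pi * x))\<^sup>2 * cos (4 * pi * d * x))
    (max 0 (1 - \<bar>d\<bar>) / 2)"
proof -
  have "has_bochner_integral lborel (\<lambda>u. (sinc u)\<^sup>2 * cos (2 * d * u))
      ((pi * \<bar>d + 1\<bar> + pi * \<bar>d - 1\<bar>) / 2 - pi * \<bar>d\<bar>)"
    unfolding sinc_square_mult_cos
    by (intro has_bochner_integral_diff has_bochner_integral_divide has_bochner_integral_add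
        has_bochner_integral_sinc_square_scaled)
  \<comment> \<open>The triangle function arises as half the second difference of the absolute
    value.\<close>
  also have "(pi * \<bar>d + 1\<bar> + pi * \<bar>d - 1\<bar>) / 2 - pi * \<bar>d\<bar> = pi * max 0 (1 - \<bar>d\<bar>)"
    by (auto simp: abs_if max_def field_simps)
  \<comment> \<open>Substitute \<open>u = 2 * pi * x\<close>; the summand 0 fits the affine
    substitution rule.\<close>
  finally have "has_bochner_integral lborel
      (\<lambda>x. (sinc (0 + (2 * pi) * x))\<^sup>2 * cos (2 * d * (0 + (2 * pi) * x)))
      ((pi * max 0 (1 - \<bar>d\<bar>)) /\<^sub>R \<bar>2 * pi\<bar>)"
    by (subst (asm) lborel_has_bochner_integral_real_affine_iff[where c = "2 * pi" and t = 0]) auto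
  moreover have "(pi * max 0 (1 - \<bar>d\<bar>)) /\<^sub>R \<bar>2 * pi\<bar> = max 0 (1 - \<bar>d\<bar>) / 2"
    by (simp add: field_simps)
  moreover have "2 * d * (0 + (2 * pi) * x) = 4 * pi * d * x" for x
    by simp
  ultimately show ?thesis
    by (simp only: add_0)
qed

lemma prod_cis: "finite A \<Longrightarrow> (\<Prod>i\<in>A. cis (f i)) = cis (\<Sum>i\<in>A. f i)"
  by (induction A rule: finite_induct) (simp_all add: cis_mult)

text \<open>Squaring the real and imaginary parts gives double sums of products of cosines and of
  sines, which \<open>cos_diff\<close> merges.\<close>

lemma norm_sum_cis_square:
  "(norm (\<Sum>i\<in>A. cis (f i)))\<^sup>2 = (\<Sum>i\<in>A. \<Sum>j\<in>A. cos (f i - f j))"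
  unfolding cmod_power2 by (simp add: cos_diff power2_eq_square sum_product sum.distrib)

lemma norm_one_plus_cis_square: "(norm (1 + cis (2 * t)))\<^sup>2 = 4 * (cos t)\<^sup>2"
proof -
  have "(norm (1 + cis (2 * t)))\<^sup>2 = (1 + cos (2 * t))\<^sup>2 + (sin (2 * t))\<^sup>2"
    by (simp add: cmod_power2)
  also have "\<dots> = 2 + 2 * cos (2 * t)"
    by (simp add: sin_squared_eq) (simp add: power2_eq_square algebra_simps)
  also have "\<dots> = 4 * (cos t)\<^sup>2"
    by (simp add: cos_double_cos)
  finally show ?thesis .
qed

lemma prod_cos_square:
  fixes f :: "'a \<Rightarrow> real"
  assumes "finite A"
  shows "(\<Prod>i\<in>A. (cos (f i))\<^sup>2) =
    (\<Sum>S\<in>Pow A. \<Sum>T\<in>Pow A. cos (2 * (sum f S - sum f T))) / 4 ^ card A"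
proof -
  have "4 ^ card A * (\<Prod>i\<in>A. (cos (f i))\<^sup>2) = (\<Prod>i\<in>A. (norm (1 + cis (2 * f i)))\<^sup>2)"
    by (simp add: norm_one_plus_cis_square prod.distrib)
  also have "\<dots> = (norm (\<Prod>i\<in>A. cis (2 * f i) + 1))\<^sup>2"
    by (simp add: prod_power_distrib add.commute flip: prod_norm)
  \<comment> \<open>\<open>S\<close> collects the factors from which the \<open>cis\<close> summand
    is chosen; the others contribute 1.\<close>
  also have "(\<Prod>i\<in>A. cis (2 * f i) + 1) = (\<Sum>S\<in>Pow A. cis (2 * sum f S))"
    unfolding prod_add[OF assms]
    by (intro sum.cong refl) (use assms in \<open>auto simp: prod_cis sum_distrib_left dest: finite_subset\<close>)
  finally show ?thesis
    by (simp add: norm_sum_cis_square field_simps)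
qed

lemma integral_sinc_square_prod_cos_square:
  fixes a :: "'a \<Rightarrow> real"
  assumes "finite A"
  shows "(LINT x|lborel. (sinc (2 * pi * x))\<^sup>2 * (\<Prod>i\<in>A. (cos (2 * pi * a i * x))\<^sup>2)) =
    (\<Sum>S\<in>Pow A. \<Sum>T\<in>Pow A. max 0 (1 - \<bar>sum a S - sum a T\<bar>) / 2) / 4 ^ card A"
proof -
  have "(sinc (2 * pi * x))\<^sup>2 * (\<Prod>i\<in>A. (cos (2 * pi * a i * x))\<^sup>2) =
      (\<Sum>S\<in>Pow A. \<Sum>T\<in>Pow A. (sinc (2 * pi * x))\<^sup>2 * cos (4 * pi * (sum a S - sum a T) * x))
        / 4 ^ card A" for x
  proof -
    have "2 * ((\<Sum>i\<in>S. 2 * pi * a i * x) - (\<Sum>i\<in>T. 2 * pi * a i * x))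
        = 4 * pi * (sum a S - sum a T) * x" for S T
      by (simp add: algebra_simps flip: sum_distrib_left sum_distrib_right)
    then show ?thesis
      unfolding prod_cos_square[OF assms] times_divide_eq_right sum_distrib_left by simp
  qed
  moreover have "has_bochner_integral lborel
      (\<lambda>x. (\<Sum>S\<in>Pow A. \<Sum>T\<in>Pow A.
        (sinc (2 * pi * x))\<^sup>2 * cos (4 * pi * (sum a S - sum a T) * x)) / 4 ^ card A)
      ((\<Sum>S\<in>Pow A. \<Sum>T\<in>Pow A. max 0 (1 - \<bar>sum a S - sum a T\<bar>) / 2) / 4 ^ card A)"
    by (intro has_bochner_integral_divide has_bochner_integral_sum
        has_bochner_integral_sinc_square_cos)
  ultimately show ?thesis
    by (simp only: has_bochner_integral_integral_eq)
qed

theorem theorem1: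
  fixes n :: nat and a :: "nat \<Rightarrow> real"
  assumes "n \<ge> 1"
    and "\<And>i. i \<in> {1..n} \<Longrightarrow> a i > 0"
  shows "(LINT x|lborel. (sinc (2 * pi * x))^2 * (\<Prod>i=1..n. (cos (2 * pi * a i * x))^2)) \<ge> 1 / 2 ^ (n + 1)
    \<and> ((LINT x|lborel. (sinc (2 * pi * x))^2 * (\<Prod>i=1..n. (cos (2 * pi * a i * x))^2)) = 1 / 2 ^ (n + 1)
      \<longleftrightarrow> (\<forall>S T. S \<subseteq> {1..n} \<and> T \<subseteq> {1..n} \<and> S \<noteq> T \<longrightarrow> \<bar>(\<Sum>i\<in>S. a i) - (\<Sum>i\<in>T. a i)\<bar> \<ge> 1))"
proof -
  let ?P = "Pow {1..n}"
  define w where "w S T = max 0 (1 - \<bar>sum a S - sum a T\<bar>) / 2" for S T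
  \<comment> \<open>The excess over the lower bound, up to the factor \<open>4 ^ n\<close>.\<close>
  define R where "R = (\<Sum>S\<in>?P. \<Sum>T\<in>?P - {S}. w S T)"
  have w_nonneg: "w S T \<ge> 0" for S T
    by (simp add: w_def)
  have w_0: "w S T = 0 \<longleftrightarrow> \<bar>sum a S - sum a T\<bar> \<ge> 1" for S T
    by (auto simp: w_def max_def)
  \<comment> \<open>The split-off diagonal term is \<open>w S S = 1 / 2\<close>.\<close>
  have inner: "(\<Sum>T\<in>?P. w S T) = 1 / 2 + (\<Sum>T\<in>?P - {S}. w S T)" if "S \<in> ?P" for S
    using that by (subst sum.remove[of _ S]) (auto simp: w_def)
  have "(\<Sum>S\<in>?P. \<Sum>T\<in>?P. w S T) = (\<Sum>S\<in>?P. 1 / 2 + (\<Sum>T\<in>?P - {S}. w S T))"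
    by (rule sum.cong[OF refl inner])
  also have "\<dots> = 2 ^ n / 2 + R"
    by (simp add: R_def sum.distrib card_Pow)
  finally have "(\<Sum>S\<in>?P. \<Sum>T\<in>?P. w S T) = 2 ^ n / 2 + R" .
  moreover have "(4::real) ^ n = 2 ^ n * 2 ^ n"
    by (simp flip: power_mult_distrib)
  ultimately have I: "(LINT x|lborel. (sinc (2 * pi * x))^2 * (\<Prod>i=1..n. (cos (2 * pi * a i * x))^2))
      = 1 / 2 ^ (n + 1) + R / 4 ^ n"
    unfolding integral_sinc_square_prod_cos_square[OF finite_atLeastAtMost] w_def
    by (simp add: field_simps)
  have "R \<ge> 0"
    unfolding R_def by (intro sum_nonneg w_nonneg)
  \<comment> \<open>Nonnegative terms cannot cancel; with \<open>w_0\<close> this becomes the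
    separation condition.\<close>
  moreover have "R = 0 \<longleftrightarrow> (\<forall>S\<in>?P. \<forall>T\<in>?P - {S}. w S T = 0)"
    unfolding R_def by (subst sum_nonneg_eq_0_iff; simp add: sum_nonneg w_nonneg sum_nonneg_eq_0_iff)+
  ultimately show ?thesis
    unfolding I w_0 by auto
qed

end
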